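(* Let $P$ be a finite poset with $\hat 0$ and $\hat 1$, $\hat 0\ne\hat 1$, let $F_1,\dots,F_N$ be a lexicographic order on the facets of the order complex $\Delta=\Delta(P)$, and let $\mathrm{Crit}(\Delta)$ be the set of critical cells of the resulting lexicographic matching $M=\bigcup_k M_k$ described in the context. Then the Möbius function of $P$ satisfies $$\mu_P(\hat 0,\hat 1)=\sum_{\sigma\in\mathrm{Crit}(\Delta)}(-1)^{|J(e\sigma)|+1},$$ where $e\sigma$ denotes the earliest facet in the order $F_1,\dots,F_N$ containing $\sigma$.
   Context: Möbius function: $\mu_P(u,u)=1$ and $\mu_P(u,w)=-\sum_{u\le v<w}\mu_P(u,v)$ for $u<w$. Order complex and facets. $\Delta(P)$ is the simplicial complex whose faces are the chains (including the empty chain) of $P\setminus\{\hat 0,\hat 1\}$. Its facets correspond to the saturated chains $\hat 0=u_0\prec u_1\prec\cdots\prec u_s=\hat 1$ of $P$ ($\prec$ denotes a covering relation); the facet has vertices $u_1,\dots,u_{s-1}$, and the rank of $u_i$ within that facet is $i$. $P$ is not assumed graded. A facet is also identified with the set of all its faces, so $F_k\setminus\bigcup_{i<k}F_i$ is the set of faces contained in $F_k$ but in no $F_i$ with $i<k$, and $F_k\cap\bigcup_{i<k}F_i$ is the complex of faces of $F_k$ lying in some earlier facet. Lexicographic order. A total order on the facets of $\Delta(P)$ such that: whenever facets $F,F'$ have the same elements at ranks $1,\dots,i$ (for some $i\ge 0$) but different elements at rank $i+1$, and $F$ precedes $F'$, then every facet containing the elements of $F$ at ranks $1,\dots,i+1$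 precedes every facet containing the elements of $F'$ at ranks $1,\dots,i+1$. Interval systems. For a lexicographic order, each inclusion-maximal face of $F_k\cap\bigcup_{i<k}F_i$ is obtained from $F_k$ by deleting the vertices in a nonempty set of consecutive ranks of $F_k$. These deleted sets are the minimal skipped intervals of $F_k$; $I(F_k)$ is the set of them ($I(F_1)=\emptyset$). The set $J(F_k)$ of pairwise disjoint intervals is obtained from $I:=I(F_k)$, starting with $J=\emptyset$, by repeating the following until $I=\emptyset$: (1) add to $J$ the interval of $I$ whose lowest element has smallest rank; (2) remove this interval from $I$ and replace every other interval of $I$ by its intersection with the set of ranks strictly above all ranks of the interval just added; (3) delete from $I$ every interval that properly contains another interval of $I$. Write $J(F_k)=\{j_1,\dots,j_r\}$ in increasing order of rank, and let $\rho_i$ be the lowest-rank element of $j_i$. The matching pairs $M_k$ (on the faces of $F_k\setminus\bigcup_{i<k}F_i$). (i) If some vertex of $F_k$ lies in no interval of $I(F_k)$, let $\rho_0$ be the lowest-rank such vertex; $M_k$ consists of the pairs $\{h\setminus\{\rho_0\},h\}$ for all faces $h\in F_k\setminus\bigcup_{i<k}F_i$ with $\rho_0\in h$. (ii) Otherwise, for a face $h\in F_k\setminus\bigcup_{i<k}F_i$ let $\tau(h)=\min\{i: 1\le i\le r,\ h\cap j_i\ne\{\rho_i\}\}$, with $\tau(h)=\infty$ if this set is empty. If $\tau(h)<\infty$, pair $h$ with $h\setminus\{\rho_{\tau(h)}\}$ if $\rho_{\tau(h)}\in h$ and with $h\cup\{\rho_{\tau(h)}\}$ otherwise. If $\tau(h)=\infty$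 and some vertex of $F_k$ lies in no interval of $J(F_k)$, let $\rho_{r+1}$ be the lowest-rank such vertex, and pair $h$ with $h\setminus\{\rho_{r+1}\}$ if $\rho_{r+1}\in h$ and with $h\cup\{\rho_{r+1}\}$ otherwise. If $\tau(h)=\infty$ and every vertex of $F_k$ lies in some interval of $J(F_k)$, then $h$ is left unpaired. Critical cells are the faces of $\Delta(P)$ (possibly the empty face) that are unmatched in $M$. *)

theory Defs
  imports Main
begin

text \<open>
  A finite poset with least and greatest element is a type of sort
  \<open>{finite, order_bot, order_top}\<close>; its bounds are \<^term>\<open>bot\<close> and \<^term>\<open>top\<close>.
\<close>

function mobius :: "'a::{finite,order} \<Rightarrow> 'a \<Rightarrow> int" where
  "mobius u w =
     (if u = w then 1
      else if u < w then - (\<Sum>v\<in>{v. u \<le> v \<and> v < w}. mobius u v)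
      else 0)"
  by pat_completeness auto
termination
proof (relation "measure (\<lambda>(u, w). card {v. v < w})")
  fix u w x :: 'a
  assume "x \<in> {v. u \<le> v \<and> v < w}"
  then have "{v. v < x} \<subset> {v. v < w}"
    by force
  then show "((u, x), u, w) \<in> measure (\<lambda>(u, w). card {v. v < w})"
    by (simp add: psubset_card_mono)
qed simp

declare mobius.simps [simp del]


definition order_complex :: "'a::{finite,order_bot,order_top} set set" where
  "order_complex = {C. Complete_Partial_Order.chain (\<le>) C \<and> bot \<notin> C \<and> top \<notin> C}"

definition facets :: "'a set set \<Rightarrow> 'a set set" where
  "facets K = {\<sigma> \<in> K. \<forall>\<tau>\<in>K. \<sigma> \<subseteq> \<tau> \<longrightarrow> \<tau> = \<sigma>}"

text \<open>
  A facet of the order complex is the set of vertices \<open>u\<^sub>1 < \<dots> < u\<^sub>s\<^sub>-\<^sub>1\<close> of a saturated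
  chain from \<^term>\<open>bot\<close> to \<^term>\<open>top\<close>; the rank of \<open>u\<^sub>i\<close> in it is its position \<open>i\<close>,
  counted from 1. The poset need not be graded, so ranks depend on the facet.
\<close>

definition rank_in :: "'a::order set \<Rightarrow> 'a \<Rightarrow> nat" where
  "rank_in C u = card {v \<in> C. v \<le> u}"

text \<open>The set of elements of rank \<open>m\<close>: a singleton, or empty if \<open>m\<close> exceeds \<open>card C\<close>.\<close>

definition at_rank :: "'a::order set \<Rightarrow> nat \<Rightarrow> 'a set" where
  "at_rank C m = {u \<in> C. rank_in C u = m}"

definition lowest :: "'a::order set \<Rightarrow> 'a set \<Rightarrow> 'a" where
  "lowest C A = arg_min_on (rank_in C) A"

definition lexicographic_order ::
  "nat \<Rightarrow> (nat \<Rightarrow> 'a::{finite,order_bot,order_top} set) \<Rightarrow> bool" where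
  "lexicographic_order N F \<longleftrightarrow>
     bij_betw F {1..N} (facets order_complex) \<and>
     (\<forall>a\<in>{1..N}. \<forall>b\<in>{1..N}. \<forall>i.
        (\<forall>m\<in>{1..i}. at_rank (F a) m = at_rank (F b) m) \<and>
        at_rank (F a) (i + 1) \<noteq> at_rank (F b) (i + 1) \<and> a < b \<longrightarrow>
        (\<forall>c\<in>{1..N}. \<forall>d\<in>{1..N}.
           (\<Union>m\<in>{1..i + 1}. at_rank (F a) m) \<subseteq> F c \<and>
           (\<Union>m\<in>{1..i + 1}. at_rank (F b) m) \<subseteq> F d \<longrightarrow> c < d))"


definition earlier_faces :: "(nat \<Rightarrow> 'a set) \<Rightarrow> nat \<Rightarrow> 'a set set" where
  "earlier_faces F k = (\<Union>i\<in>{1..<k}. Pow (F i))"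

definition new_faces :: "(nat \<Rightarrow> 'a set) \<Rightarrow> nat \<Rightarrow> 'a set set" where
  "new_faces F k = Pow (F k) - earlier_faces F k"

text \<open>
  The minimal skipped intervals \<open>I(F\<^sub>k)\<close>, as sets of vertices of \<open>F k\<close>. That their
  elements have consecutive ranks is a consequence of the lexicographic property.
\<close>

definition skipped_intervals :: "(nat \<Rightarrow> 'a set) \<Rightarrow> nat \<Rightarrow> 'a set set" where
  "skipped_intervals F k = (\<lambda>\<sigma>. F k - \<sigma>) ` facets (Pow (F k) \<inter> earlier_faces F k)"

text \<open>
  The set of intervals selected by the truncation procedure from the set \<open>I\<close> of intervals
  of the facet \<open>C\<close>.
\<close>

definition above :: "'a::order set \<Rightarrow> 'a set \<Rightarrow> 'a set" where
  "above C A = {v \<in> C. \<forall>a\<in>A. rank_in C a < rank_in C v}"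

function truncate_intervals :: "'a::{finite,order} set \<Rightarrow> 'a set set \<Rightarrow> 'a set set" where
  "truncate_intervals C I =
     (if I = {} then {}
      else let A = arg_min_on (\<lambda>B. rank_in C (lowest C B)) I;
               I' = (\<lambda>B. B \<inter> above C A) ` (I - {A})
           in insert A (truncate_intervals C {B \<in> I'. \<not> (\<exists>B'\<in>I'. B' \<subset> B)}))"
  by pat_completeness auto
termination
proof (relation "measure (\<lambda>(C, I). card I)")
  fix C :: "'a set" and I A I'
  assume "I \<noteq> {}" and A: "A = arg_min_on (\<lambda>B. rank_in C (lowest C B)) I"
    and I': "I' = (\<lambda>B. B \<inter> above C A) ` (I - {A})"
  have "card {B \<in> I'. \<not> (\<exists>B'\<in>I'. B' \<subset> B)} \<le> card I'"
    by (rule card_mono) auto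
  also have "\<dots> \<le> card (I - {A})"
    unfolding I' by (rule card_image_le) simp
  also have "\<dots> < card I"
    using \<open>I \<noteq> {}\<close> by (intro card_Diff1_less) (auto simp: A intro!: arg_min_if_finite)
  finally show "((C, {B \<in> I'. \<not> (\<exists>B'\<in>I'. B' \<subset> B)}), C, I) \<in> measure (\<lambda>(C, I). card I)"
    by simp
qed simp

declare truncate_intervals.simps [simp del]

definition J_intervals :: "(nat \<Rightarrow> 'a::{finite,order} set) \<Rightarrow> nat \<Rightarrow> 'a set set" where
  "J_intervals F k = truncate_intervals (F k) (skipped_intervals F k)"


text \<open>\<open>j\<^sub>1, \<dots>, j\<^sub>r\<close> in increasing order of rank; list positions start at 0, so \<open>j\<^sub>i\<close> is entry \<open>i - 1\<close>.\<close>

definition J_list :: "(nat \<Rightarrow> 'a::{finite,order} set) \<Rightarrow> nat \<Rightarrow> 'a set list" where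
  "J_list F k = sorted_key_list_of_set (\<lambda>B. rank_in (F k) (lowest (F k) B)) (J_intervals F k)"

definition rho :: "(nat \<Rightarrow> 'a::{finite,order} set) \<Rightarrow> nat \<Rightarrow> nat \<Rightarrow> 'a" where
  "rho F k i = lowest (F k) (J_list F k ! i)"

text \<open>The set whose minimum is \<open>\<tau>(h)\<close>; it is empty precisely when \<open>\<tau>(h) = \<infinity>\<close>.\<close>

definition tau_set :: "(nat \<Rightarrow> 'a::{finite,order} set) \<Rightarrow> nat \<Rightarrow> 'a set \<Rightarrow> nat set" where
  "tau_set F k h = {i. i < length (J_list F k) \<and> h \<inter> J_list F k ! i \<noteq> {rho F k i}}"

definition toggle :: "'a \<Rightarrow> 'a set \<Rightarrow> 'a set" where
  "toggle x h = (if x \<in> h then h - {x} else insert x h)"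

definition matching_pairs :: "(nat \<Rightarrow> 'a::{finite,order} set) \<Rightarrow> nat \<Rightarrow> 'a set set set" where
  "matching_pairs F k =
     (let U = F k - \<Union> (skipped_intervals F k);
          V = F k - \<Union> (J_intervals F k)
      in if U \<noteq> {} then
           {{h - {lowest (F k) U}, h} |h. h \<in> new_faces F k \<and> lowest (F k) U \<in> h}
         else
           {{h, toggle (rho F k (Min (tau_set F k h))) h} |h.
              h \<in> new_faces F k \<and> tau_set F k h \<noteq> {}} \<union>
           {{h, toggle (lowest (F k) V) h} |h.
              h \<in> new_faces F k \<and> tau_set F k h = {} \<and> V \<noteq> {}})"

definition lexicographic_matching ::
  "nat \<Rightarrow> (nat \<Rightarrow> 'a::{finite,order} set) \<Rightarrow> 'a set set set" where
  "lexicographic_matching N F = (\<Union>k\<in>{1..N}. matching_pairs F k)"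

definition critical_cells ::
  "nat \<Rightarrow> (nat \<Rightarrow> 'a::{finite,order_bot,order_top} set) \<Rightarrow> 'a set set" where
  "critical_cells N F = {\<sigma> \<in> order_complex. \<not> (\<exists>p\<in>lexicographic_matching N F. \<sigma> \<in> p)}"

text \<open>The index \<open>k\<close> with \<open>F\<^sub>k = e\<sigma>\<close>.\<close>

definition earliest :: "nat \<Rightarrow> (nat \<Rightarrow> 'a set) \<Rightarrow> 'a set \<Rightarrow> nat" where
  "earliest N F \<sigma> = (LEAST k. k \<in> {1..N} \<and> \<sigma> \<subseteq> F k)"

end

theory Submission
  imports Defs
begin

text \<open>
  By Philip Hall's theorem the Moebius number is the sum of \<open>(-1)\<^bsup>|h| + 1\<^esup>\<close> over all faces \<open>h\<close>, and
  the faces are partitioned by the earliest facet containing them. A face of \<open>F\<^sub>k\<close> is new iff it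
  meets every minimal skipped interval of \<open>F\<^sub>k\<close>. On the new faces of \<open>F\<^sub>k\<close> the matching toggles a
  vertex that depends only on data unaffected by the toggle, so it is a sign-reversing involution,
  whose only possible fixed face is \<open>{\<rho>\<^sub>1, \<dots>, \<rho>\<^sub>r}\<close>, with \<open>r = |J(F\<^sub>k)|\<close> vertices.

  That toggling keeps a face new rests on three properties of the truncation procedure: every
  interval of \<open>I(F\<^sub>k)\<close> contains some \<open>j\<^sub>m\<close>; every \<open>j\<^sub>i\<close> arises from an interval of \<open>I(F\<^sub>k)\<close> by deleting
  only elements of earlier \<open>j\<^sub>l\<close> other than \<open>\<rho>\<^sub>l\<close>; and the members of \<open>I(F\<^sub>k)\<close> are convex in \<open>F\<^sub>k\<close>,
  which is where the lexicographic property enters.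
\<close>

section \<open>Ranks and the truncation procedure\<close>

lemma chainD_le:
  "Complete_Partial_Order.chain (\<le>) C \<Longrightarrow> x \<in> C \<Longrightarrow> y \<in> C \<Longrightarrow> x \<le> y \<or> y \<le> x"
  by (simp add: Complete_Partial_Order.chain_def)

lemma rank_in_less_iff:
  fixes C :: "'a::{finite,order} set"
  assumes "Complete_Partial_Order.chain (\<le>) C" "u \<in> C" "v \<in> C"
  shows "rank_in C u < rank_in C v \<longleftrightarrow> u < v"
proof
  assume "u < v"
  then have "{w \<in> C. w \<le> u} \<subset> {w \<in> C. w \<le> v}"
    using assms by (auto dest: less_le_not_le[THEN iffD1])
  then show "rank_in C u < rank_in C v"
    unfolding rank_in_def by (simp add: psubset_card_mono)
next
  assume *: "rank_in C u < rank_in C v"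
  have "\<not> v \<le> u"
  proof
    assume "v \<le> u"
    then have "rank_in C v \<le> rank_in C u"
      unfolding rank_in_def by (intro card_mono) auto
    then show False using * by simp
  qed
  then show "u < v"
    using chainD_le[OF assms] by auto
qed

lemma inj_on_rank_in:
  fixes C :: "'a::{finite,order} set"
  assumes "Complete_Partial_Order.chain (\<le>) C"
  shows "inj_on (rank_in C) C"
proof (rule inj_onI)
  fix u v assume "u \<in> C" "v \<in> C" "rank_in C u = rank_in C v"
  then show "u = v"
    using rank_in_less_iff[OF assms, of u v] rank_in_less_iff[OF assms, of v u]
      chainD_le[OF assms, of u v] by auto
qed

lemma rank_in_image:
  fixes C :: "'a::{finite,order} set"
  assumes "Complete_Partial_Order.chain (\<le>) C"
  shows "rank_in C ` C = {1..card C}"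
proof (rule card_subset_eq)
  show "rank_in C ` C \<subseteq> {1..card C}"
    by (auto simp: rank_in_def Suc_le_eq card_gt_0_iff intro!: card_mono)
  show "card (rank_in C ` C) = card {1..card C}"
    using card_image[OF inj_on_rank_in[OF assms]] by simp
qed simp

lemma lowest_in: "B \<noteq> {} \<Longrightarrow> lowest C B \<in> B" for B :: "'a::{finite,order} set"
  unfolding lowest_def by (rule arg_min_if_finite) auto

lemma lowest_le:
  fixes C :: "'a::{finite,order} set"
  assumes "Complete_Partial_Order.chain (\<le>) C" "B \<subseteq> C" "b \<in> B"
  shows "lowest C B \<le> b"
proof -
  have "\<not> rank_in C b < rank_in C (lowest C B)"
    using arg_min_if_finite(2)[of B "rank_in C"] assms(3) unfolding lowest_def by auto
  moreover have "lowest C B \<in> B"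
    using assms(3) by (auto intro: lowest_in)
  ultimately show ?thesis
    using assms rank_in_less_iff[OF assms(1), of b "lowest C B"]
      chainD_le[OF assms(1), of b "lowest C B"] by (auto simp: less_le subset_iff)
qed

text \<open>Consecutive ranks are expressed as order convexity inside \<open>C\<close>. For a chain
  this is the same thing, and it avoids arithmetic on ranks.\<close>

definition interval_of :: "'a::order set \<Rightarrow> 'a set \<Rightarrow> bool" where
  "interval_of C B \<longleftrightarrow>
     B \<subseteq> C \<and> B \<noteq> {} \<and> (\<forall>x\<in>B. \<forall>z\<in>B. \<forall>y\<in>C. x \<le> y \<and> y \<le> z \<longrightarrow> y \<in> B)"

definition antichain :: "'a set set \<Rightarrow> bool" where
  "antichain I \<longleftrightarrow> (\<forall>A\<in>I. \<forall>B\<in>I. \<not> A \<subset> B)"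

definition precedes :: "'a::order set \<Rightarrow> 'a set \<Rightarrow> bool" where
  "precedes A B \<longleftrightarrow> (\<forall>a\<in>A. \<forall>b\<in>B. a < b)"

lemma interval_ofD:
  "interval_of C B \<Longrightarrow> x \<in> B \<Longrightarrow> z \<in> B \<Longrightarrow> y \<in> C \<Longrightarrow> x \<le> y \<Longrightarrow> y \<le> z \<Longrightarrow> y \<in> B"
  unfolding interval_of_def by blast

text \<open>If \<open>a\<close> and \<open>b\<close> witnessed incomparability, the smaller of them
  would lie between the common lowest element and the larger one, so convexity would put it into
  both intervals.\<close>

lemma interval_same_lowest:
  fixes C :: "'a::{finite,order} set"
  assumes C: "Complete_Partial_Order.chain (\<le>) C"
    and A: "interval_of C A" and B: "interval_of C B" and "lowest C A = lowest C B"
  shows "A \<subseteq> B \<or> B \<subseteq> A"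
proof (rule ccontr)
  assume "\<not> ?thesis"
  then obtain a b where ab: "a \<in> A" "a \<notin> B" "b \<in> B" "b \<notin> A" by blast
  have sub: "A \<subseteq> C" "A \<noteq> {}" "B \<subseteq> C" "B \<noteq> {}"
    using A B by (auto simp: interval_of_def)
  have low: "lowest C A \<in> A" "lowest C A \<in> B" "lowest C A \<le> a" "lowest C A \<le> b"
    using lowest_in[of A C] lowest_in[of B C] lowest_le[OF C, of A a] lowest_le[OF C, of B b]
      ab sub assms(4) by auto
  have "a \<le> b \<or> b \<le> a"
    using chainD_le[OF C] ab sub by blast
  then show False
    using interval_ofD[OF A low(1) ab(1), of b] interval_ofD[OF B low(2) ab(3), of a] low ab sub
    by blast
qed

text \<open>Since \<open>I\<close> is an antichain, \<open>A\<close> and \<open>B\<close> have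
  different lowest elements, and that of \<open>A\<close> is the smaller. An element of
  \<open>B\<close> that is not above all of \<open>A\<close> therefore lies strictly above
  \<open>lowest C A\<close> and below some element of \<open>A\<close>, so convexity puts it into
  \<open>A\<close>. Truncating by \<open>A\<close> thus never removes \<open>lowest C A\<close> from
  another interval.\<close>

lemma first_interval_absorbs:
  fixes C :: "'a::{finite,order} set"
  assumes C: "Complete_Partial_Order.chain (\<le>) C"
    and int: "\<forall>B\<in>I. interval_of C B" and anti: "antichain I" and "I \<noteq> {}"
    and A: "A = arg_min_on (\<lambda>B. rank_in C (lowest C B)) I"
    and B: "B \<in> I" "B \<noteq> A"
  shows "B - above C A \<subseteq> A - {lowest C A}"
proof
  have "A \<in> I" and minA: "\<And>B. B \<in> I \<Longrightarrow> \<not> rank_in C (lowest C B) < rank_in C (lowest C A)"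
    using arg_min_if_finite[of I "\<lambda>B. rank_in C (lowest C B)"] \<open>I \<noteq> {}\<close> unfolding A by auto
  have iA: "interval_of C A" and iB: "interval_of C B"
    using \<open>A \<in> I\<close> B int by auto
  have sub: "A \<subseteq> C" "A \<noteq> {}" "B \<subseteq> C" "B \<noteq> {}"
    using iA iB by (auto simp: interval_of_def)
  have lA: "lowest C A \<in> A" and lB: "lowest C B \<in> B"
    using sub by (auto intro: lowest_in)
  have "lowest C A \<noteq> lowest C B"
    using interval_same_lowest[OF C iA iB] anti \<open>A \<in> I\<close> B unfolding antichain_def by blast
  moreover have "\<not> lowest C B < lowest C A"
    using minA[OF B(1)] rank_in_less_iff[OF C, of "lowest C B" "lowest C A"] lA lB sub by blast
  ultimately have less: "lowest C A < lowest C B"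
    using chainD_le[OF C, of "lowest C A" "lowest C B"] lA lB sub
    by (auto simp: less_le subset_iff)
  fix b assume b: "b \<in> B - above C A"
  then have "b \<in> C" using sub by auto
  with b obtain a where a: "a \<in> A" "\<not> rank_in C a < rank_in C b"
    unfolding above_def by auto
  have "b \<le> a"
    using a chainD_le[OF C, of a b] rank_in_less_iff[OF C, of a b] \<open>b \<in> C\<close> sub
    by (auto simp: less_le)
  moreover have "lowest C A < b"
    using less lowest_le[OF C, of B b] sub b by auto
  ultimately show "b \<in> A - {lowest C A}"
    using interval_ofD[OF iA lA a(1) \<open>b \<in> C\<close>] by auto
qed

section \<open>Invariants of the truncation procedure\<close>

lemma exists_minimal_subset:
  assumes "finite \<A>" "X \<in> \<A>"
  shows "\<exists>B\<in>\<A>. B \<subseteq> X \<and> \<not> (\<exists>B'\<in>\<A>. B' \<subset> B)"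
  using finite_has_minimal2[OF assms] by (metis psubset_eq)

text \<open>All four claims go through one induction along the recursion. The first shows that the
  interval \<open>A\<close> chosen first precedes everything chosen later, which the second and the
  fourth need. The fourth accumulates, round by round, the elements that
  \<open>first_interval_absorbs\<close> allows to be cut off.\<close>

lemma truncate_intervals_props:
  fixes C :: "'a::{finite,order} set"
  assumes "Complete_Partial_Order.chain (\<le>) C"
    and "\<forall>B\<in>I. interval_of C B" and "antichain I"
  defines "J \<equiv> truncate_intervals C I"
  shows truncate_intervals_sub: "\<forall>j\<in>J. j \<noteq> {} \<and> (\<exists>B\<in>I. j \<subseteq> B)"
    and truncate_intervals_total: "\<forall>j\<in>J. \<forall>j'\<in>J. j = j' \<or> precedes j j' \<or> precedes j' j"
    and truncate_intervals_contained: "\<forall>B\<in>I. \<exists>j\<in>J. j \<subseteq> B"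
    and truncate_intervals_source:
      "\<forall>j\<in>J. \<exists>A\<in>I. A \<subseteq> j \<union> \<Union>{j' - {lowest C j'} |j'. j' \<in> J \<and> precedes j' j}"
proof -
  let ?S = "\<lambda>I J. \<forall>j\<in>J. j \<noteq> {} \<and> (\<exists>B\<in>I. j \<subseteq> B)"
  let ?T = "\<lambda>J. \<forall>j\<in>J. \<forall>j'\<in>J. j = j' \<or> precedes j j' \<or> precedes j' j"
  let ?K = "\<lambda>I J. \<forall>B\<in>I. \<exists>j\<in>J. j \<subseteq> B"
  let ?R = "\<lambda>C I J. \<forall>j\<in>J. \<exists>A\<in>I. A \<subseteq> j \<union> \<Union>{j' - {lowest C j'} |j'. j' \<in> J \<and> precedes j' j}"
  have "?S I J \<and> ?T J \<and> ?K I J \<and> ?R C I J"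
    unfolding J_def using assms(1-3)
  proof (induction C I rule: truncate_intervals.induct)
    case (1 C I)
    show ?case
    proof (cases "I = {}")
      case True
      then show ?thesis by (simp add: truncate_intervals.simps)
    next
      case False
      define A where "A = arg_min_on (\<lambda>B. rank_in C (lowest C B)) I"
      define I' where "I' = (\<lambda>B. B \<inter> above C A) ` (I - {A})"
      define I'' where "I'' = {B \<in> I'. \<not> (\<exists>B'\<in>I'. B' \<subset> B)}"
      define J where "J = truncate_intervals C I''"
      have Jeq: "truncate_intervals C I = insert A J"
        using False unfolding J_def I''_def I'_def A_def
        by (subst truncate_intervals.simps) (simp add: Let_def)
      note C = "1.prems"(1) and int = "1.prems"(2) and anti = "1.prems"(3)
      have "A \<in> I"
        unfolding A_def using False by (intro arg_min_if_finite) auto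
      have absorb: "B - above C A \<subseteq> A - {lowest C A}" if "B \<in> I" "B \<noteq> A" for B
        using first_interval_absorbs[OF C int anti False A_def that] .
      have "interval_of C (B \<inter> above C A)" if B: "B \<in> I" "B \<noteq> A" for B
      proof -
        have iB: "interval_of C B" using B int by auto
        \<comment> \<open>An interval truncated to nothing would lie inside \<open>A\<close>,
          against the antichain property.\<close>
        have "B \<inter> above C A \<noteq> {}"
        proof
          assume "B \<inter> above C A = {}"
          then have "B \<subseteq> A" using absorb[OF B] by blast
          then show False using anti \<open>A \<in> I\<close> B unfolding antichain_def by blast
        qed
        moreover have "y \<in> B \<inter> above C A"
          if "x \<in> B \<inter> above C A" "z \<in> B \<inter> above C A" "y \<in> C" "x \<le> y" "y \<le> z" for x y z
        proof -
          have "y \<in> B" using interval_ofD[OF iB] that by blast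
          moreover have "rank_in C x \<le> rank_in C y"
            unfolding rank_in_def using that by (intro card_mono) auto
          then have "y \<in> above C A" using that unfolding above_def by fastforce
          ultimately show ?thesis by simp
        qed
        moreover have "B \<inter> above C A \<subseteq> C"
          unfolding above_def by blast
        ultimately show ?thesis
          unfolding interval_of_def by (intro conjI ballI impI) blast+
      qed
      then have int'': "\<forall>B\<in>I''. interval_of C B"
        unfolding I''_def I'_def by auto
      \<comment> \<open>Truncation may create inclusions between intervals; keeping only the minimal
        ones restores the hypothesis of the induction.\<close>
      have anti'': "antichain I''"
        unfolding antichain_def I''_def by blast
      have "?S I'' J \<and> ?T J \<and> ?K I'' J \<and> ?R C I'' J"
        using "1.IH"[OF False A_def I'_def] C int'' anti'' unfolding J_def I''_def by simp
      then have IHS: "?S I'' J" and IHT: "?T J" and IHK: "?K I'' J" and IHR: "?R C I'' J"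
        by blast+
      have I''_D: "\<exists>B\<in>I. B \<noteq> A \<and> B' = B \<inter> above C A" if "B' \<in> I''" for B'
        using that unfolding I''_def I'_def by blast
      have "A \<subseteq> C" "A \<noteq> {}" using int \<open>A \<in> I\<close> by (auto simp: interval_of_def)
      have prec: "precedes A j" if "j \<in> J" for j
      proof -
        obtain B' where B': "B' \<in> I''" "j \<subseteq> B'" using bspec[OF IHS \<open>j \<in> J\<close>] by blast
        then have "j \<subseteq> above C A" using I''_D[OF B'(1)] by blast
        then show ?thesis
          unfolding precedes_def
        proof (intro ballI)
          fix a b assume "j \<subseteq> above C A" "a \<in> A" "b \<in> j"
          then have "b \<in> C" "rank_in C a < rank_in C b" by (auto simp: above_def)
          then show "a < b"
            using rank_in_less_iff[OF C] \<open>a \<in> A\<close> \<open>A \<subseteq> C\<close> by blast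
        qed
      qed
      have "?S I (insert A J)"
      proof (intro ballI)
        fix j assume "j \<in> insert A J"
        then show "j \<noteq> {} \<and> (\<exists>B\<in>I. j \<subseteq> B)"
        proof
          assume "j = A"
          then show ?thesis using \<open>A \<in> I\<close> \<open>A \<noteq> {}\<close> by blast
        next
          assume "j \<in> J"
          then obtain B' where B': "j \<noteq> {}" "B' \<in> I''" "j \<subseteq> B'" using bspec[OF IHS] by blast
          then show ?thesis using I''_D[OF B'(2)] by blast
        qed
      qed
      moreover have "?T (insert A J)"
      proof (intro ballI)
        fix j j' assume "j \<in> insert A J" "j' \<in> insert A J"
        then show "j = j' \<or> precedes j j' \<or> precedes j' j"
          using IHT prec by (elim insertE) blast+
      qed
      moreover have "?K I (insert A J)"
      proof
        fix B assume "B \<in> I"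
        show "\<exists>j\<in>insert A J. j \<subseteq> B"
        proof (cases "B = A")
          case False
          then have "B \<inter> above C A \<in> I'" using \<open>B \<in> I\<close> unfolding I'_def by blast
          \<comment> \<open>The truncation of \<open>B\<close> may itself have been discarded, but
            then a smaller interval inside it survives.\<close>
          then obtain B' where "B' \<in> I''" "B' \<subseteq> B \<inter> above C A"
            using exists_minimal_subset[of I' "B \<inter> above C A"] unfolding I''_def by auto
          moreover from this obtain j where "j \<in> J" "j \<subseteq> B'" using bspec[OF IHK] by blast
          ultimately show ?thesis by blast
        qed auto
      qed
      moreover have "?R C I (insert A J)"
      proof
        fix j assume "j \<in> insert A J"
        then show "\<exists>A'\<in>I. A' \<subseteq> j \<union> \<Union>{j' - {lowest C j'} |j'. j' \<in> insert A J \<and> precedes j' j}"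
        proof
          assume "j = A"
          then show ?thesis using \<open>A \<in> I\<close> by blast
        next
          assume j: "j \<in> J"
          then obtain B' where B': "B' \<in> I''"
            "B' \<subseteq> j \<union> \<Union>{j' - {lowest C j'} |j'. j' \<in> J \<and> precedes j' j}" using bspec[OF IHR] by blast
          then obtain B where B: "B \<in> I" "B \<noteq> A" "B' = B \<inter> above C A" using I''_D[OF B'(1)] by blast
          \<comment> \<open>Undoing one truncation adds only elements of \<open>A\<close> other than
            its lowest, and \<open>A\<close> precedes \<open>j\<close>.\<close>
          have "B \<subseteq> B' \<union> (A - {lowest C A})" using absorb[OF B(1,2)] B(3) by blast
          also have "\<dots> \<subseteq> j \<union> \<Union>{j' - {lowest C j'} |j'. j' \<in> insert A J \<and> precedes j' j}"
            using B'(2) prec[OF j] by blast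
          finally show ?thesis using B(1) by blast
        qed
      qed
      ultimately show ?thesis unfolding Jeq by blast
    qed
  qed
  then show "?S I J" "?T J" "?K I J" "?R C I J" by - (elim conjE, assumption)+
qed

section \<open>Skipped intervals of a lexicographic order\<close>

lemma facets_maximal:
  assumes "C \<in> facets order_complex" "x \<noteq> bot" "x \<noteq> top" "\<And>c. c \<in> C \<Longrightarrow> x \<le> c \<or> c \<le> x"
  shows "x \<in> C"
proof -
  have "insert x C \<in> order_complex"
    using assms unfolding facets_def order_complex_def Complete_Partial_Order.chain_def by blast
  then show ?thesis using assms(1) unfolding facets_def by blast
qed

lemma facets_chain:
  "C \<in> facets order_complex \<Longrightarrow> Complete_Partial_Order.chain (\<le>) C"
  by (simp add: facets_def order_complex_def)

text \<open>An element that could be added to the spliced chain is comparable to \<open>v\<close>.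
  If it is below \<open>v\<close> it is comparable to all of \<open>A\<close>, otherwise to all of
  \<open>B\<close>, so the maximality of one of the two chains applies.\<close>

lemma facets_splice:
  fixes A B :: "'a::{finite,order_bot,order_top} set"
  assumes A: "A \<in> facets order_complex" and B: "B \<in> facets order_complex"
    and v: "v \<in> A" "v \<in> B"
  shows "{w \<in> A. w < v} \<union> {w \<in> B. v \<le> w} \<in> facets order_complex" (is "?G \<in> _")
proof -
  have chA: "Complete_Partial_Order.chain (\<le>) A" and chB: "Complete_Partial_Order.chain (\<le>) B"
    using A B by (auto intro: facets_chain)
  have bounds: "bot \<notin> A" "top \<notin> A" "bot \<notin> B" "top \<notin> B"
    using A B by (auto simp: facets_def order_complex_def)
  have "x \<le> y \<or> y \<le> x" if "x \<in> ?G" "y \<in> ?G" for x y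
    using that chainD_le[OF chA, of x y] chainD_le[OF chB, of x y] by auto
  then have G: "?G \<in> order_complex"
    using bounds by (auto simp: order_complex_def Complete_Partial_Order.chain_def)
  have "w \<in> ?G" if T: "T \<in> order_complex" "?G \<subseteq> T" "w \<in> T" for T w
  proof -
    have w: "w \<noteq> bot" "w \<noteq> top" using T by (auto simp: order_complex_def)
    have comp: "w \<le> c \<or> c \<le> w" if "c \<in> ?G" for c
      using T that by (auto simp: order_complex_def Complete_Partial_Order.chain_def)
    have "w \<le> v \<or> v \<le> w" using comp[of v] v by blast
    then consider "v \<le> w" | "w < v" by (auto simp: less_le)
    then show ?thesis
    proof cases
      case 1
      have "w \<le> c \<or> c \<le> w" if "c \<in> B" for c
        using 1 comp[of c] that chainD_le[OF chB v(2) that] by auto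
      then have "w \<in> B" using facets_maximal[OF B w] by blast
      then show ?thesis using 1 by blast
    next
      case 2
      have "w \<le> c \<or> c \<le> w" if "c \<in> A" for c
        using 2 comp[of c] that chainD_le[OF chA v(1) that] by (auto simp: less_le)
      then have "w \<in> A" using facets_maximal[OF A w] by blast
      then show ?thesis using 2 by blast
    qed
  qed
  then show ?thesis using G unfolding facets_def by blast
qed

text \<open>Turns the unions in the definition of a lexicographic order into bounds on ranks.
  Nothing is lost by starting at 1, since every element counts itself.\<close>

lemma UN_at_rank:
  fixes C :: "'a::{finite,order} set"
  shows "(\<Union>m\<in>{1..i}. at_rank C m) = {u \<in> C. rank_in C u \<le> i}"
proof -
  have "1 \<le> rank_in C u" if "u \<in> C" for u
    using that by (auto simp: rank_in_def Suc_le_eq card_gt_0_iff)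
  then show ?thesis by (auto simp: at_rank_def)
qed

lemma at_rank_nonempty:
  fixes C :: "'a::{finite,order} set"
  assumes "Complete_Partial_Order.chain (\<le>) C" "u \<in> C" "i < rank_in C u"
  shows "at_rank C (i + 1) \<noteq> {}"
proof -
  have "rank_in C u \<in> {1..card C}"
    using rank_in_image[OF assms(1)] assms(2) by blast
  then have "i + 1 \<in> rank_in C ` C"
    using assms(3) unfolding rank_in_image[OF assms(1)] by simp
  then show ?thesis by (auto simp: at_rank_def)
qed

lemma lexicographic_orderD:
  assumes "lexicographic_order N F" "a \<in> {1..N}" "b \<in> {1..N}" "c \<in> {1..N}" "d \<in> {1..N}" "a < b"
    "\<forall>m\<in>{1..i}. at_rank (F a) m = at_rank (F b) m" "at_rank (F a) (i + 1) \<noteq> at_rank (F b) (i + 1)"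
    "(\<Union>m\<in>{1..i + 1}. at_rank (F a) m) \<subseteq> F c" "(\<Union>m\<in>{1..i + 1}. at_rank (F b) m) \<subseteq> F d"
  shows "c < d"
  using assms unfolding lexicographic_order_def by blast

text \<open>The least rank of disagreement works. Neither facet can end before it: that facet would
  consist of the common initial part only and be contained in the other, so maximality would make
  them equal.\<close>

lemma first_difference:
  fixes A B :: "'a::{finite,order_bot,order_top} set"
  assumes A: "A \<in> facets order_complex" and B: "B \<in> facets order_complex" and "A \<noteq> B"
  obtains i x y where "\<forall>m\<in>{1..i}. at_rank A m = at_rank B m" "at_rank A (i + 1) \<noteq> at_rank B (i + 1)"
    "x \<in> at_rank A (i + 1)" "y \<in> at_rank B (i + 1)"
proof -
  have chA: "Complete_Partial_Order.chain (\<le>) A" and chB: "Complete_Partial_Order.chain (\<le>) B"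
    using A B by (auto intro: facets_chain)
  \<comment> \<open>Beyond \<open>n\<close> neither facet has vertices, so agreement at the ranks up
    to \<open>n\<close> would force equality.\<close>
  define n where "n = max (card A) (card B)"
  have all: "(\<Union>m\<in>{1..n}. at_rank C m) = C" if "C = A \<or> C = B" for C
  proof -
    have "rank_in C u \<le> card C" for u
      unfolding rank_in_def by (intro card_mono) auto
    moreover have "card C \<le> n" using that by (auto simp: n_def)
    ultimately show ?thesis unfolding UN_at_rank using order_trans by blast
  qed
  let ?P = "\<lambda>i. at_rank A (i + 1) \<noteq> at_rank B (i + 1)"
  have "\<exists>i. ?P i"
  proof (rule ccontr)
    assume "\<not> ?thesis"
    then have "at_rank A m = at_rank B m" if "m \<in> {1..n}" for m
      using that by (auto dest: spec[of _ "m - 1"])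
    then show False using all[of A] all[of B] \<open>A \<noteq> B\<close> by simp
  qed
  define i where "i = Least ?P"
  have Pi: "?P i" unfolding i_def by (rule LeastI_ex) fact
  have eq: "\<forall>m\<in>{1..i}. at_rank A m = at_rank B m"
  proof
    fix m assume "m \<in> {1..i}"
    then have "m - 1 < i" "m - 1 + 1 = m" by auto
    then show "at_rank A m = at_rank B m"
      using not_less_Least[of "m - 1" ?P] unfolding i_def by metis
  qed
  then have pre: "{u \<in> A. rank_in A u \<le> i} = {u \<in> B. rank_in B u \<le> i}"
    unfolding UN_at_rank[symmetric] by auto
  have sub: "C = D" if "C \<in> facets order_complex" "D \<in> facets order_complex" "C \<subseteq> D" for C D :: "'a set"
    using that unfolding facets_def by blast
  have "\<exists>u\<in>A. i < rank_in A u"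
    using pre sub[OF A B] \<open>A \<noteq> B\<close> by (force simp: not_less)
  moreover have "\<exists>u\<in>B. i < rank_in B u"
    using pre sub[OF B A] \<open>A \<noteq> B\<close> by (force simp: not_less)
  ultimately have "at_rank A (i + 1) \<noteq> {}" "at_rank B (i + 1) \<noteq> {}"
    using at_rank_nonempty[OF chA] at_rank_nonempty[OF chB] by blast+
  then show ?thesis using that[OF eq Pi] by blast
qed

text \<open>
  Following the earlier facet \<open>F i\<close> from where it branches off \<open>F k\<close> until both meet again, and
  \<open>F k\<close> from there on, gives a facet that is still earlier than \<open>F k\<close>.
\<close>

lemma earlier_facet_skipping_interval:
  fixes F :: "nat \<Rightarrow> 'a::{finite,order_bot,order_top} set"
  assumes lex: "lexicographic_order N F" and k: "k \<in> {1..N}" and i: "i \<in> {1..<k}"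
  obtains g where "g \<in> {1..<k}" "F i \<inter> F k \<subseteq> F g" "interval_of (F k) (F k - F g)"
proof -
  have bij: "bij_betw F {1..N} (facets order_complex)"
    using lex by (simp add: lexicographic_order_def)
  have iN: "i \<in> {1..N}" using i k by auto
  have Fi: "F i \<in> facets order_complex" and Fk: "F k \<in> facets order_complex"
    using bij k iN by (auto simp: bij_betw_def)
  have ch: "Complete_Partial_Order.chain (\<le>) (F i)" "Complete_Partial_Order.chain (\<le>) (F k)"
    using Fi Fk by (auto intro: facets_chain)
  have "F i \<noteq> F k" using bij k i iN by (auto simp: bij_betw_def dest: inj_onD)
  then obtain a y x where a: "\<forall>m\<in>{1..a}. at_rank (F i) m = at_rank (F k) m"
    "at_rank (F i) (a + 1) \<noteq> at_rank (F k) (a + 1)" "y \<in> at_rank (F i) (a + 1)" "x \<in> at_rank (F k) (a + 1)"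
    using first_difference[OF Fi Fk] by metis
  have y: "y \<in> F i" "rank_in (F i) y = a + 1" and x: "x \<in> F k" "rank_in (F k) x = a + 1"
    using a by (auto simp: at_rank_def)
  \<comment> \<open>\<open>P\<close> is the common initial part, and \<open>y\<close> and
    \<open>x\<close> are the first vertices of \<open>F i\<close> and \<open>F k\<close> after
    it.\<close>
  define P where "P = {u \<in> F k. rank_in (F k) u \<le> a}"
  have P: "P = {u \<in> F i. rank_in (F i) u \<le> a}"
    unfolding P_def UN_at_rank[symmetric] using a(1) by auto
  have Pk: "p \<in> F k" "rank_in (F k) p \<le> a" and Pi: "p \<in> F i" "rank_in (F i) p \<le> a" if "p \<in> P" for p
    using that P unfolding P_def by blast+
  have P_below: "p < x" "p < y" if "p \<in> P" for p
    using Pk[OF that] Pi[OF that] x y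
      rank_in_less_iff[OF ch(1), of p y] rank_in_less_iff[OF ch(2), of p x] by simp_all
  have x_le: "x \<le> u" if "u \<in> F k" "u \<notin> P" for u
    using that x chainD_le[OF ch(2), of x u] rank_in_less_iff[OF ch(2), of u x]
    by (auto simp: P_def less_le)
  have y_le: "y \<le> u" if "u \<in> F i" "u \<notin> P" for u
    using that y chainD_le[OF ch(1), of y u] rank_in_less_iff[OF ch(1), of u y]
    by (auto simp: P less_le)
  \<comment> \<open>These are the common vertices beyond the branching; the lowest of them will be
    the place where the facets meet again.\<close>
  define M where "M = (F i \<inter> F k) - P"
  \<comment> \<open>Otherwise \<open>y\<close> is at most \<open>x\<close>, hence comparable to all
    of \<open>F k\<close>, hence in \<open>F k\<close> by maximality. Then \<open>x = y\<close>, and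
    the facets would agree at rank \<open>a + 1\<close>.\<close>
  have xy: "x \<notin> F i"
  proof
    assume xi: "x \<in> F i"
    have "x \<notin> P" "y \<notin> P" using P_below by blast+
    then have "y \<le> x" using y_le[OF xi] by blast
    have "y \<in> F k"
    proof (rule facets_maximal[OF Fk])
      show "y \<noteq> bot" "y \<noteq> top" using Fi y by (auto simp: facets_def order_complex_def)
      show "y \<le> c \<or> c \<le> y" if "c \<in> F k" for c
        using x_le[OF that] P_below(2)[of c] \<open>y \<le> x\<close> by (cases "c \<in> P") (auto simp: less_le)
    qed
    then have "x = y" using x_le[of y] \<open>y \<notin> P\<close> \<open>y \<le> x\<close> by auto
    then have "at_rank (F i) (a + 1) = {x}" "at_rank (F k) (a + 1) = {x}"
      using x y inj_onD[OF inj_on_rank_in[OF ch(1)]] inj_onD[OF inj_on_rank_in[OF ch(2)]]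
      by (auto simp: at_rank_def)
    then show False using a(2) by simp
  qed
  have Y: "y \<notin> P" "x \<notin> P" using P_below by blast+
  have yk: "y \<notin> F k"
  proof
    assume yk: "y \<in> F k"
    have "x \<le> y" using x_le[OF yk Y(1)] .
    have "x \<in> F i"
    proof (rule facets_maximal[OF Fi])
      show "x \<noteq> bot" "x \<noteq> top" using Fk x by (auto simp: facets_def order_complex_def)
      show "x \<le> c \<or> c \<le> x" if "c \<in> F i" for c
        using y_le[OF that] P_below(1)[of c] \<open>x \<le> y\<close> by (cases "c \<in> P") (auto simp: less_le)
    qed
    then show False using xy by simp
  qed
  \<comment> \<open>A vertex between two vertices outside \<open>G\<close> is not in
    \<open>P\<close> by \<open>conv\<close>, and it cannot be in \<open>G\<close> since
    \<open>up\<close> would then put the upper one into \<open>G\<close>. The vertex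
    \<open>x\<close> witnesses nonemptiness.\<close>
  have int: "interval_of (F k) (F k - G)" if "x \<notin> G"
    and conv: "\<And>u w. u \<in> F k - G \<Longrightarrow> w \<in> F k \<Longrightarrow> u \<le> w \<Longrightarrow> w \<notin> P"
    and up: "\<And>w z. w \<in> F k \<inter> G - P \<Longrightarrow> z \<in> F k \<Longrightarrow> w \<le> z \<Longrightarrow> z \<in> G" for G
    unfolding interval_of_def using that(1) x(1) conv up by blast
  have notP: "w \<notin> P" if "u \<in> F k" "u \<notin> P" "w \<in> F k" "u \<le> w" for u w
    using x_le[OF that(1,2)] P_below(1)[of w] that by auto
  \<comment> \<open>A facet containing \<open>P\<close> and \<open>y\<close> contains everything
    that \<open>F i\<close> has up to rank \<open>a + 1\<close>, so the lexicographic property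
    carries \<open>i < k\<close> over to \<open>g < k\<close>.\<close>
  have index: "g \<in> {1..<k}" if "g \<in> {1..N}" "P \<subseteq> F g" "y \<in> F g" for g
  proof -
    have "(\<Union>m\<in>{1..a + 1}. at_rank (F i) m) \<subseteq> F g"
    proof
      fix u assume "u \<in> (\<Union>m\<in>{1..a + 1}. at_rank (F i) m)"
      then have u: "u \<in> F i" "rank_in (F i) u \<le> a + 1" unfolding UN_at_rank by auto
      show "u \<in> F g"
      proof (cases "rank_in (F i) u \<le> a")
        case True
        then show ?thesis using u that(2) unfolding P by blast
      next
        case False
        then have "u = y" using u y inj_onD[OF inj_on_rank_in[OF ch(1)], of u y] by simp
        then show ?thesis using that(3) by simp
      qed
    qed
    moreover have "(\<Union>m\<in>{1..a + 1}. at_rank (F k) m) \<subseteq> F k"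
      unfolding UN_at_rank by blast
    ultimately have "g < k"
      using lexicographic_orderD[OF lex iN k that(1) k _ a(1,2)] i by simp
    then show ?thesis using that(1) by simp
  qed
  have P_sub: "P \<subseteq> F i" "P \<subseteq> F k" using Pi Pk by blast+
  show thesis
  \<comment> \<open>If the facets never meet again, \<open>F i\<close> itself skips everything after
    \<open>P\<close>.\<close>
  proof (cases "M = {}")
    case True
    then have "F i \<inter> F k \<subseteq> P" unfolding M_def by blast
    then have "interval_of (F k) (F k - F i)"
      using P_sub notP by (intro int xy) blast+
    then show thesis using that[of i] i by blast
  next
    case False
    define v where "v = lowest (F k) M"
    have "v \<in> M" and v_le: "v \<le> u" if "u \<in> M" for u
      using lowest_in[OF False] lowest_le[OF ch(2), of M] that unfolding v_def M_def by blast+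
    then have v: "v \<in> F i" "v \<in> F k" "v \<notin> P" using False unfolding M_def by blast+
    define G where "G = {w \<in> F i. w < v} \<union> {w \<in> F k. v \<le> w}"
    have "G \<in> facets order_complex"
      unfolding G_def by (rule facets_splice[OF Fi Fk v(1,2)])
    then obtain g where g: "g \<in> {1..N}" "F g = G"
      using bij unfolding bij_betw_def by (metis imageE)
    have "y \<le> v" "x \<le> v" "y \<noteq> v" "x \<noteq> v" using y_le[OF v(1,3)] x_le[OF v(2,3)] v yk xy by auto
    then have "y < v" "x < v" by auto
    have PG: "P \<subseteq> G"
      using P_below(1) \<open>x < v\<close> P_sub unfolding G_def by (auto dest: less_trans)
    have "y \<in> G" using y \<open>y < v\<close> unfolding G_def by blast
    then have "g \<in> {1..<k}" using index[OF g(1)] PG g by simp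
    moreover have "F i \<inter> F k \<subseteq> F g"
      using PG v_le unfolding g(2) G_def M_def by blast
    moreover have "interval_of (F k) (F k - G)"
    proof (rule int)
      show "x \<notin> G" using \<open>x < v\<close> xy unfolding G_def by (auto simp: less_le_not_le)
      show "w \<notin> P" if "u \<in> F k - G" "w \<in> F k" "u \<le> w" for u w
        using that notP PG by blast
      show "z \<in> G" if w: "w \<in> F k \<inter> G - P" "z \<in> F k" "w \<le> z" for w z
      proof -
        \<comment> \<open>A vertex of \<open>G\<close> below \<open>v\<close> comes from
          \<open>F i\<close>; being in \<open>F k\<close> and outside \<open>P\<close> it would
          belong to \<open>M\<close>, of which \<open>v\<close> is the least element.\<close>
        have "v \<le> w" using w(1) v_le[of w] unfolding G_def M_def by auto
        then have "v \<le> z" using w(3) by (rule order_trans)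
        then show ?thesis using w(2) unfolding G_def by blast
      qed
    qed
    ultimately show thesis using that[of g] g by blast
  qed
qed

text \<open>A maximal face \<open>s\<close> shared with some \<open>F i\<close> lies in
  \<open>F k \<inter> F g\<close> for the facet \<open>F g\<close> of the preceding lemma.
  Maximality makes the two equal, so the deleted set is \<open>F k - F g\<close>.\<close>

lemma skipped_intervals_interval:
  fixes F :: "nat \<Rightarrow> 'a::{finite,order_bot,order_top} set"
  assumes lex: "lexicographic_order N F" and k: "k \<in> {1..N}" and B: "B \<in> skipped_intervals F k"
  shows "interval_of (F k) B"
proof -
  obtain s where s: "s \<in> facets (Pow (F k) \<inter> earlier_faces F k)" "B = F k - s"
    using B unfolding skipped_intervals_def by blast
  then obtain i where i: "i \<in> {1..<k}" "s \<subseteq> F i" "s \<subseteq> F k"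
    unfolding facets_def earlier_faces_def by blast
  obtain g where g: "g \<in> {1..<k}" "F i \<inter> F k \<subseteq> F g" "interval_of (F k) (F k - F g)"
    using earlier_facet_skipping_interval[OF lex k i(1)] .
  have "F k \<inter> F g \<in> Pow (F k) \<inter> earlier_faces F k" "s \<subseteq> F k \<inter> F g"
    using g i unfolding earlier_faces_def by blast+
  then have "F k \<inter> F g = s" using s(1) unfolding facets_def by blast
  then have "B = F k - F g" using s(2) by blast
  then show ?thesis using g(3) by simp
qed

text \<open>Complements of maximal faces inside \<open>F k\<close> inherit incomparability.\<close>

lemma antichain_skipped_intervals: "antichain (skipped_intervals F k)"
  unfolding antichain_def
proof (intro ballI notI)
  fix A B assume "A \<in> skipped_intervals F k" "B \<in> skipped_intervals F k" "A \<subset> B"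
  then obtain s t where s: "s \<in> facets (Pow (F k) \<inter> earlier_faces F k)" "A = F k - s"
    and t: "t \<in> facets (Pow (F k) \<inter> earlier_faces F k)" "B = F k - t"
    unfolding skipped_intervals_def by blast
  have "s \<subseteq> F k" "t \<subseteq> F k" using s(1) t(1) unfolding facets_def by simp_all
  then have "t \<subset> s" using s(2) t(2) \<open>A \<subset> B\<close> by blast
  moreover from this have "s = t" using s(1) t(1) unfolding facets_def by simp
  ultimately show False by simp
qed

text \<open>By finiteness, a face of \<open>F k\<close> lies in an earlier facet exactly when it
  lies in a maximal such face, that is, when it misses the complement of that face.\<close>

lemma new_faces_iff:
  fixes F :: "nat \<Rightarrow> 'a::finite set"
  shows "h \<in> new_faces F k \<longleftrightarrow> h \<subseteq> F k \<and> (\<forall>B\<in>skipped_intervals F k. h \<inter> B \<noteq> {})"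
proof (intro iffI conjI ballI)
  assume h: "h \<in> new_faces F k"
  then show "h \<subseteq> F k" by (simp add: new_faces_def)
  fix B assume "B \<in> skipped_intervals F k"
  then obtain s where "s \<in> facets (Pow (F k) \<inter> earlier_faces F k)" "B = F k - s"
    unfolding skipped_intervals_def by blast
  then have "s \<in> earlier_faces F k" "B = F k - s" by (simp_all add: facets_def)
  moreover have "h \<subseteq> F k" "h \<notin> earlier_faces F k" using h by (simp_all add: new_faces_def)
  ultimately show "h \<inter> B \<noteq> {}"
    unfolding earlier_faces_def by blast
next
  assume h: "h \<subseteq> F k \<and> (\<forall>B\<in>skipped_intervals F k. h \<inter> B \<noteq> {})"
  have "h \<notin> earlier_faces F k"
  proof
    assume "h \<in> earlier_faces F k"
    then have "h \<in> Pow (F k) \<inter> earlier_faces F k" using h by blast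
    then obtain s where s: "s \<in> Pow (F k) \<inter> earlier_faces F k" "h \<subseteq> s"
      "\<forall>t\<in>Pow (F k) \<inter> earlier_faces F k. s \<subseteq> t \<longrightarrow> s = t"
      using finite_has_maximal2[of "Pow (F k) \<inter> earlier_faces F k" h] by auto
    then have "s \<in> facets (Pow (F k) \<inter> earlier_faces F k)"
      by (auto simp: facets_def)
    then have "F k - s \<in> skipped_intervals F k"
      unfolding skipped_intervals_def by (rule imageI)
    then show False using h s(2) by blast
  qed
  then show "h \<in> new_faces F k" using h by (simp add: new_faces_def)
qed

section \<open>The matching on the new faces of one facet\<close>

lemma toggle_toggle [simp]: "toggle x (toggle x h) = h"
  by (auto simp: toggle_def)

text \<open>As the toggled vertex is the same for both members of a pair, the map is an involution
  on \<open>S\<close>. It changes cardinality by one, so the sum equals its own negative.\<close>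

lemma sum_sign_toggle:
  fixes S :: "'a::finite set set"
  assumes closed: "\<And>h. h \<in> S \<Longrightarrow> toggle (x h) h \<in> S"
    and x: "\<And>h. h \<in> S \<Longrightarrow> x (toggle (x h) h) = x h"
  shows "(\<Sum>h\<in>S. (-1) ^ (card h + 1)) = (0::int)"
proof -
  let ?f = "\<lambda>h. toggle (x h) h"
  have sign: "(-1) ^ (card (toggle y h) + 1) = - ((-1::int) ^ (card h + 1))" for y and h :: "'a set"
  proof (cases "y \<in> h")
    case True
    then have "card h = Suc (card (h - {y}))" by (intro card.remove) simp_all
    then show ?thesis using True by (simp add: toggle_def)
  qed (simp add: toggle_def)
  have "(\<Sum>h\<in>S. (-1) ^ (card h + 1)) = (\<Sum>h\<in>S. (-1::int) ^ (card (?f h) + 1))"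
    by (rule sum.reindex_bij_witness[of S ?f ?f]) (simp_all add: closed x)
  also have "\<dots> = - (\<Sum>h\<in>S. (-1) ^ (card h + 1))"
    by (simp only: sign sum_negf)
  finally show ?thesis by simp
qed

text \<open>The lexicographic order enters the analysis of a single facet only through these two
  properties.\<close>

locale facet_intervals =
  fixes F :: "nat \<Rightarrow> 'a::{finite,order} set" and k :: nat
  assumes chain_facet: "Complete_Partial_Order.chain (\<le>) (F k)"
    and intervals: "\<forall>B\<in>skipped_intervals F k. interval_of (F k) B"
begin

abbreviation "I \<equiv> skipped_intervals F k"
abbreviation "J \<equiv> J_intervals F k"
abbreviation "j \<equiv> nth (J_list F k)"
abbreviation "r \<equiv> length (J_list F k)"
abbreviation "\<rho> \<equiv> rho F k"

lemmas J_sub = truncate_intervals_sub[OF chain_facet intervals antichain_skipped_intervals,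
    folded J_intervals_def]
lemmas J_total = truncate_intervals_total[OF chain_facet intervals antichain_skipped_intervals,
    folded J_intervals_def]
lemmas J_contained = truncate_intervals_contained[OF chain_facet intervals antichain_skipped_intervals,
    folded J_intervals_def]
lemmas J_source = truncate_intervals_source[OF chain_facet intervals antichain_skipped_intervals,
    folded J_intervals_def]

section \<open>The selected intervals as a list ordered by rank\<close>

lemma J_nonempty: "A \<in> J \<Longrightarrow> A \<noteq> {}"
  using bspec[OF J_sub] by blast

lemma J_subset:
  assumes "A \<in> J"
  shows "A \<subseteq> F k"
proof -
  obtain B where B: "B \<in> I" "A \<subseteq> B" using bspec[OF J_sub assms] by blast
  then have "B \<subseteq> F k" using bspec[OF intervals B(1)] by (simp add: interval_of_def)
  then show ?thesis using B(2) by blast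
qed

lemma precedes_imp_rank_less:
  assumes "A \<in> J" "B \<in> J" "precedes A B"
  shows "rank_in (F k) (lowest (F k) A) < rank_in (F k) (lowest (F k) B)"
proof -
  have "lowest (F k) A \<in> A" "lowest (F k) B \<in> B"
    using assms J_nonempty by (auto intro: lowest_in)
  then show ?thesis
    using assms J_subset rank_in_less_iff[OF chain_facet, of "lowest (F k) A" "lowest (F k) B"]
    unfolding precedes_def by blast
qed

text \<open>Distinct selected intervals precede one another in one direction, so the sorting key is
  injective on \<open>J\<close> and the sorted list enumerates \<open>J\<close>. Strictly increasing
  keys rule out the reverse precedence.\<close>

lemma J_list_props:
  shows set_J_list: "set (J_list F k) = J"
    and length_J_list: "r = card J"
    and precedes_J_list: "i < l \<Longrightarrow> l < r \<Longrightarrow> precedes (j i) (j l)"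
proof -
  let ?key = "\<lambda>B. rank_in (F k) (lowest (F k) B)"
  have inj: "inj_on ?key J"
    using J_total precedes_imp_rank_less by (intro inj_onI) (metis less_irrefl)
  interpret folding_insort_key "(\<le>)" "(<)" J ?key
    by unfold_locales (rule inj)
  show set: "set (J_list F k) = J" and "r = card J"
    unfolding J_list_def sorted_key_list_of_set_dict by simp_all
  have sorted: "sorted_wrt (<) (map ?key (J_list F k))"
    unfolding J_list_def sorted_key_list_of_set_dict by (rule strict_sorted_key_list_of_set) simp
  show "precedes (j i) (j l)" if "i < l" "l < r"
  proof -
    have less: "?key (j i) < ?key (j l)"
      using sorted_wrt_nth_less[OF sorted that(1)] that by simp
    have "j i \<in> J" "j l \<in> J"
      using that nth_mem[of i "J_list F k"] nth_mem[of l "J_list F k"] unfolding set by auto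
    then show ?thesis
      using bspec[OF bspec[OF J_total], of "j i" "j l"] precedes_imp_rank_less[of "j l" "j i"] less
      by auto
  qed
qed

lemma j_in: "i < r \<Longrightarrow> j i \<in> J"
  using nth_mem[of i "J_list F k"] unfolding set_J_list .

lemma J_index: "A \<in> J \<Longrightarrow> \<exists>i<r. A = j i"
  unfolding set_J_list[symmetric] in_set_conv_nth by blast

lemma rho_in: "i < r \<Longrightarrow> \<rho> i \<in> j i"
  unfolding rho_def by (intro lowest_in J_nonempty j_in)

lemma j_subset: "i < r \<Longrightarrow> j i \<subseteq> F k"
  by (intro J_subset j_in)

lemma rho_le: "i < r \<Longrightarrow> e \<in> j i \<Longrightarrow> \<rho> i \<le> e"
  unfolding rho_def by (intro lowest_le chain_facet j_subset)

lemma j_disjoint: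
  assumes "i < r" "l < r" "e \<in> j i" "e \<in> j l"
  shows "i = l"
proof (rule ccontr)
  assume "i \<noteq> l"
  then have "precedes (j i) (j l) \<or> precedes (j l) (j i)"
    using precedes_J_list assms by (metis nat_neq_iff)
  then show False using assms(3,4) unfolding precedes_def by blast
qed

lemma j_contained: "B \<in> I \<Longrightarrow> \<exists>m<r. j m \<subseteq> B"
  using bspec[OF J_contained] J_index by blast

text \<open>The last truncation property restated by list positions: precedence of
  \<open>j l\<close> before \<open>j i\<close> gives \<open>\<rho> l < \<rho> i\<close>, which
  forces \<open>l < i\<close>. Consequently a new face that meets every earlier \<open>j l\<close>
  only in \<open>\<rho> l\<close> must meet \<open>j i\<close>.\<close>

lemma j_source:
  assumes "i < r"
  shows "\<exists>A\<in>I. \<forall>e\<in>A. e \<in> j i \<or> (\<exists>l<i. e \<in> j l \<and> e \<noteq> \<rho> l)"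
proof -
  obtain A where A: "A \<in> I"
    "A \<subseteq> j i \<union> \<Union>{j' - {lowest (F k) j'} |j'. j' \<in> J \<and> precedes j' (j i)}"
    using bspec[OF J_source j_in[OF assms]] by blast
  have "e \<in> j i \<or> (\<exists>l<i. e \<in> j l \<and> e \<noteq> \<rho> l)" if "e \<in> A" for e
  proof (cases "e \<in> j i")
    case False
    then have "e \<in> \<Union>{j' - {lowest (F k) j'} |j'. j' \<in> J \<and> precedes j' (j i)}"
      using subsetD[OF A(2) that] by simp
    then obtain j' where j': "j' \<in> J" "precedes j' (j i)" "e \<in> j'" "e \<noteq> lowest (F k) j'"
      by auto
    then obtain l where l: "l < r" "j' = j l" using J_index by blast
    have "\<rho> l < \<rho> i"
      using j'(2) rho_in[OF l(1)] rho_in[OF assms] unfolding precedes_def l(2) by blast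
    have "l < i"
    proof (rule ccontr)
      assume "\<not> l < i"
      then consider "l = i" | "i < l" by linarith
      then have "\<not> \<rho> l < \<rho> i"
      proof cases
        case 2
        then show ?thesis
          using precedes_J_list[OF 2 l(1)] rho_in[OF l(1)] rho_in[OF assms]
          unfolding precedes_def by (meson order_less_asym)
      qed simp
      then show False using \<open>\<rho> l < \<rho> i\<close> by simp
    qed
    then show ?thesis using j' l(2) unfolding rho_def by blast
  qed simp
  then show ?thesis using A(1) by blast
qed

section \<open>Toggles that preserve new faces\<close>

lemma tau_setD: "l < r \<Longrightarrow> l \<notin> tau_set F k h \<Longrightarrow> h \<inter> j l = {\<rho> l}"
  unfolding tau_set_def by blast

text \<open>The face \<open>h\<close> contains some \<open>e\<close> in \<open>j i\<close> other
  than \<open>\<rho> i\<close>. This element survives the toggle; it keeps \<open>i\<close> in the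
  set defining tau and replaces \<open>\<rho> i\<close> where that vertex was the only one meeting a
  skipped interval.\<close>

lemma toggle_rho:
  assumes h: "h \<in> new_faces F k" and tau: "tau_set F k h \<noteq> {}"
  defines "i \<equiv> Min (tau_set F k h)"
  defines "h' \<equiv> toggle (\<rho> i) h"
  shows "h' \<in> new_faces F k" "tau_set F k h' \<noteq> {}" "Min (tau_set F k h') = i"
proof -
  have fin: "finite (tau_set F k g)" for g unfolding tau_set_def by simp
  have "i \<in> tau_set F k h" unfolding i_def using fin tau by (rule Min_in)
  then have i: "i < r" "h \<inter> j i \<noteq> {\<rho> i}" by (simp_all add: tau_set_def)
  have before: "h \<inter> j l = {\<rho> l}" if "l < i" for l
  proof (rule tau_setD)
    show "l < r" using that i by simp
    show "l \<notin> tau_set F k h"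
      using Min_le[OF fin, of l h] that unfolding i_def[symmetric] by auto
  qed
  have hC: "h \<subseteq> F k" and hit: "\<And>B. B \<in> I \<Longrightarrow> h \<inter> B \<noteq> {}"
    using h unfolding new_faces_iff by blast+
  \<comment> \<open>The source interval of \<open>j i\<close> is met by \<open>h\<close>, but not in
    an earlier \<open>j l\<close>, where \<open>h\<close> has only \<open>\<rho> l\<close>.\<close>
  have "h \<inter> j i \<noteq> {}"
  proof -
    obtain A where A: "A \<in> I" "\<forall>e\<in>A. e \<in> j i \<or> (\<exists>l<i. e \<in> j l \<and> e \<noteq> \<rho> l)"
      using j_source[OF i(1)] by blast
    then show ?thesis using hit[OF A(1)] before by blast
  qed
  then obtain e where e: "e \<in> h" "e \<in> j i" "e \<noteq> \<rho> i" using i(2) by blast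
  have other: "z \<in> h' \<longleftrightarrow> z \<in> h" if "z \<noteq> \<rho> i" for z
    using that by (auto simp: h'_def toggle_def)
  have "h' \<inter> B \<noteq> {}" if B: "B \<in> I" for B
  \<comment> \<open>Only an interval met by \<open>h\<close> in nothing but \<open>\<rho> i\<close>
    is at risk. It contains some selected \<open>j m\<close>, and the position of \<open>m\<close>
    relative to \<open>i\<close> supplies a surviving vertex.\<close>
  proof (cases "h \<inter> B \<subseteq> {\<rho> i}")
    case False
    then show ?thesis using other by blast
  next
    case True
    then have "\<rho> i \<in> B" using hit[OF B] by blast
    obtain m where m: "m < r" "j m \<subseteq> B" using j_contained[OF B] by blast
    consider "m < i" | "m = i" | "i < m" by linarith
    then show ?thesis
    proof cases
      case 1
      have "\<rho> m \<noteq> \<rho> i"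
        using 1 j_disjoint[OF m(1) i(1) rho_in[OF m(1)]] rho_in[OF i(1)] by auto
      moreover have "\<rho> m \<in> h" using before[OF 1] by blast
      ultimately show ?thesis using other rho_in[OF m(1)] m(2) by blast
    next
      case 2
      then show ?thesis using e other m(2) by blast
    next
      \<comment> \<open>Here \<open>e\<close> lies between \<open>\<rho> i\<close> and
        \<open>\<rho> m\<close>, both in \<open>B\<close>, so convexity of \<open>B\<close>
        applies.\<close>
      case 3
      have iB: "interval_of (F k) B" using intervals B by blast
      have "e \<in> F k" using e(1) hC by blast
      have "e < \<rho> m"
        using precedes_J_list[OF 3 m(1)] e(2) rho_in[OF m(1)] unfolding precedes_def by blast
      then have "e \<in> B"
        using interval_ofD[OF iB \<open>\<rho> i \<in> B\<close> _ \<open>e \<in> F k\<close> rho_le[OF i(1) e(2)], of "\<rho> m"]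
          m(2) rho_in[OF m(1)] by (simp add: subset_iff less_imp_le)
      then show ?thesis using e other by blast
    qed
  qed
  moreover have "h' \<subseteq> F k"
    using hC rho_in[OF i(1)] j_subset[OF i(1)] by (auto simp: h'_def toggle_def)
  ultimately show "h' \<in> new_faces F k" unfolding new_faces_iff by blast
  have "i \<in> tau_set F k h'"
    using i(1) e other unfolding tau_set_def by blast
  then show "tau_set F k h' \<noteq> {}" by blast
  show "Min (tau_set F k h') = i"
  proof (rule Min_eqI[OF fin])
    show "i \<in> tau_set F k h'" by fact
    fix l assume l: "l \<in> tau_set F k h'"
    show "i \<le> l"
    proof (rule ccontr)
      assume "\<not> i \<le> l"
      then have "l < i" "l < r" using i by auto
      \<comment> \<open>By disjointness the toggle does not affect the intersections with earlier
        selected intervals, so the minimum cannot drop.\<close>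
      then have "\<rho> i \<notin> j l" using j_disjoint[OF i(1) _ rho_in[OF i(1)]] by auto
      then have "z \<in> h' \<longleftrightarrow> z \<in> h" if "z \<in> j l" for z
        using other[of z] that by metis
      then have "h' \<inter> j l = h \<inter> j l" by blast
      then show False using before[OF \<open>l < i\<close>] l unfolding tau_set_def by auto
    qed
  qed
qed

text \<open>Every skipped interval contains some \<open>j m\<close>, and \<open>h\<close> contains
  \<open>\<rho> m\<close>.\<close>

lemma new_if_tau_empty:
  assumes "h \<subseteq> F k" "tau_set F k h = {}"
  shows "h \<in> new_faces F k"
  unfolding new_faces_iff
proof (intro conjI ballI)
  fix B assume "B \<in> I"
  then obtain m where m: "m < r" "j m \<subseteq> B" using j_contained by blast
  then have "h \<inter> j m = {\<rho> m}" using tau_setD assms(2) by blast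
  then show "h \<inter> B \<noteq> {}" using m(2) by blast
qed (rule assms)

lemma toggle_unselected:
  assumes h: "h \<in> new_faces F k" "tau_set F k h = {}" and x: "x \<in> F k" "x \<notin> \<Union>J"
  shows "toggle x h \<in> new_faces F k" "tau_set F k (toggle x h) = {}"
proof -
  have "toggle x h \<inter> j l = h \<inter> j l" if "l < r" for l
    using x(2) j_in[OF that] unfolding toggle_def by auto
  then show tau: "tau_set F k (toggle x h) = {}"
    using h(2) unfolding tau_set_def by auto
  have "toggle x h \<subseteq> F k"
    using h(1) x(1) unfolding new_faces_iff by (auto simp: toggle_def)
  then show "toggle x h \<in> new_faces F k" using tau by (rule new_if_tau_empty)
qed

lemma toggle_unskipped:
  assumes "h \<in> new_faces F k" "x \<in> F k" "x \<notin> \<Union>I"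
  shows "toggle x h \<in> new_faces F k"
proof -
  have "toggle x h \<inter> B = h \<inter> B" if "B \<in> I" for B
    using assms(3) that unfolding toggle_def by auto
  then show ?thesis
    using assms unfolding new_faces_iff by (auto simp: toggle_def)
qed

text \<open>When the selected intervals cover the facet, a face is determined by its intersections
  with them, and these are prescribed.\<close>

lemma tau_empty_unique:
  assumes "F k \<subseteq> \<Union>J"
  shows "{h \<in> new_faces F k. tau_set F k h = {}} = {\<rho> ` {..<r}}"
proof -
  have "h = \<rho> ` {..<r}" if h: "h \<in> new_faces F k" "tau_set F k h = {}" for h
  proof -
    have eq: "h \<inter> j l = {\<rho> l}" if "l < r" for l using tau_setD[OF that] h(2) by blast
    have "h \<subseteq> \<Union>J" using h(1) assms unfolding new_faces_iff by blast
    then have "\<exists>l<r. e \<in> j l" if "e \<in> h" for e using that J_index by blast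
    then show ?thesis using eq by blast
  qed
  moreover have "\<rho> ` {..<r} \<inter> j l = {\<rho> l}" if "l < r" for l
    using j_disjoint[OF _ that rho_in] rho_in[OF that] that by blast
  then have tau: "tau_set F k (\<rho> ` {..<r}) = {}" unfolding tau_set_def by blast
  moreover have "\<rho> ` {..<r} \<subseteq> F k" using rho_in j_subset by blast
  ultimately show ?thesis using new_if_tau_empty[OF _ tau] by blast
qed

lemma card_rho: "card (\<rho> ` {..<r}) = card J"
proof -
  have "inj_on \<rho> {..<r}"
    using j_disjoint rho_in by (intro inj_onI) (metis lessThan_iff)
  then show ?thesis by (simp add: card_image length_J_list)
qed

definition unmatched :: "'a set set" where
  "unmatched = {h \<in> new_faces F k. \<not> (\<exists>p\<in>matching_pairs F k. h \<in> p)}"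

text \<open>All faces cancel by toggling, except possibly those with infinite tau when the selected
  intervals cover the facet. Then a single face remains, with \<open>card J\<close> vertices, which
  is why \<open>card J\<close> may replace its cardinality on the right.\<close>

lemma matching_pairs_new_and_sum:
  shows matching_pairs_subset: "\<forall>p\<in>matching_pairs F k. p \<subseteq> new_faces F k"
    and sum_new_faces: "(\<Sum>h\<in>new_faces F k. (-1) ^ (card h + 1)) =
      (\<Sum>h\<in>unmatched. (-1) ^ (card J + 1) :: int)"
proof -
  let ?N = "new_faces F k"
  let ?S = "\<lambda>A. \<Sum>h\<in>A. (-1) ^ (card h + 1) :: int"
  have "(\<forall>p\<in>matching_pairs F k. p \<subseteq> ?N) \<and> ?S ?N = (\<Sum>h\<in>unmatched. (-1) ^ (card J + 1))"
  proof (cases "F k - \<Union>I = {}")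
    case False
    define x where "x = lowest (F k) (F k - \<Union>I)"
    have x: "x \<in> F k" "x \<notin> \<Union>I" using lowest_in[OF False, of "F k"] unfolding x_def by auto
    note tog = toggle_unskipped[OF _ x]
    have M: "matching_pairs F k = {{h - {x}, h} |h. h \<in> ?N \<and> x \<in> h}"
      using False unfolding matching_pairs_def x_def by (simp add: Let_def)
    have "p \<subseteq> ?N" if "p \<in> matching_pairs F k" for p
    proof -
      obtain h where h: "p = {h - {x}, h}" "h \<in> ?N" "x \<in> h" using \<open>p \<in> _\<close> unfolding M by blast
      then show ?thesis using tog[OF h(2)] by (simp add: toggle_def)
    qed
    moreover have "?S ?N = 0"
      by (rule sum_sign_toggle[of ?N "\<lambda>_. x"]) (auto intro: tog)
    \<comment> \<open>Pairs are indexed by their larger member, so a face without \<open>x\<close>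
      is reached through \<open>insert x h\<close>.\<close>
    moreover have "\<exists>p\<in>matching_pairs F k. h \<in> p" if "h \<in> ?N" for h
    proof (cases "x \<in> h")
      case True
      then have "{h - {x}, h} \<in> matching_pairs F k" using that unfolding M by auto
      then show ?thesis by blast
    next
      case False
      then have "insert x h \<in> ?N" "insert x h - {x} = h"
        using tog[OF that] by (simp_all add: toggle_def)
      then have "{h, insert x h} \<in> matching_pairs F k"
        unfolding M by (intro CollectI exI[of _ "insert x h"]) auto
      then show ?thesis by blast
    qed
    then have "unmatched = {}" unfolding unmatched_def by blast
    ultimately show ?thesis by simp
  next
    case True
    define V where "V = F k - \<Union>J"
    \<comment> \<open>The faces with finite tau form \<open>N1\<close>, those with infinite tau
      \<open>N2\<close>; each toggle stays within its class.\<close>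
    define N1 where "N1 = {h \<in> ?N. tau_set F k h \<noteq> {}}"
    define N2 where "N2 = {h \<in> ?N. tau_set F k h = {}}"
    define x where "x h = \<rho> (Min (tau_set F k h))" for h
    have M: "matching_pairs F k = {{h, toggle (x h) h} |h. h \<in> N1} \<union>
        {{h, toggle (lowest (F k) V) h} |h. h \<in> N2 \<and> V \<noteq> {}}"
      using True unfolding matching_pairs_def N1_def N2_def V_def x_def by (simp add: Let_def conj_assoc)
    have t1: "toggle (x h) h \<in> N1" "x (toggle (x h) h) = x h" if "h \<in> N1" for h
      using toggle_rho[of h] that unfolding N1_def x_def by simp_all
    have S1: "?S N1 = 0" by (rule sum_sign_toggle[of N1 x]) (simp_all add: t1)
    have split: "?N = N1 \<union> N2" "N1 \<inter> N2 = {}" unfolding N1_def N2_def by blast+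
    then have S: "?S ?N = ?S N2" using S1 by (simp add: sum.union_disjoint)
    have m1: "\<exists>p\<in>matching_pairs F k. h \<in> p" if "h \<in> N1" for h
    proof -
      have "{h, toggle (x h) h} \<in> matching_pairs F k" using that unfolding M by auto
      then show ?thesis by blast
    qed
    show ?thesis
    proof (cases "V = {}")
      case False
      define y where "y = lowest (F k) V"
      have y: "y \<in> F k" "y \<notin> \<Union>J" using lowest_in[OF False, of "F k"] unfolding y_def V_def by auto
      have t2: "toggle y h \<in> N2" if "h \<in> N2" for h
        using toggle_unselected[of h y] y that unfolding N2_def by simp
      have "?S N2 = 0" by (rule sum_sign_toggle[of N2 "\<lambda>_. y"]) (simp_all add: t2)
      moreover have "\<exists>p\<in>matching_pairs F k. h \<in> p" if "h \<in> N2" for h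
      proof -
        have "{h, toggle y h} \<in> matching_pairs F k" using that False unfolding M y_def by auto
        then show ?thesis by blast
      qed
      then have "unmatched = {}" using m1 split(1) unfolding unmatched_def by blast
      moreover have "p \<subseteq> ?N" if "p \<in> matching_pairs F k" for p
        using that t1(1) t2 split(1) unfolding M y_def[symmetric] by auto
      ultimately show ?thesis using S by simp
    next
      case True
      then have M': "matching_pairs F k = {{h, toggle (x h) h} |h. h \<in> N1}" unfolding M by simp
      have N2: "N2 = {\<rho> ` {..<r}}"
        unfolding N2_def by (rule tau_empty_unique) (use True V_def in blast)
      have sub: "p \<subseteq> N1" if "p \<in> matching_pairs F k" for p
        using that t1(1) unfolding M' by auto
      then have "unmatched = N2" using m1 split unfolding unmatched_def by blast
      moreover have "?S N2 = (\<Sum>h\<in>N2. (-1) ^ (card J + 1))" unfolding N2 by (simp add: card_rho)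
      ultimately show ?thesis using S sub split(1) by auto
    qed
  qed
  then show "\<forall>p\<in>matching_pairs F k. p \<subseteq> ?N" "?S ?N = (\<Sum>h\<in>unmatched. (-1) ^ (card J + 1))"
    by - (elim conjE, assumption)+
qed

end

section \<open>The theorem of Philip Hall and the main result\<close>

text \<open>Removing the greatest element \<open>v\<close> maps the nonempty chains bijectively to
  pairs of \<open>v\<close> and a chain below it, and flips the sign. The summand \<open>- 1\<close>
  is the empty chain.\<close>

lemma sum_sign_chains:
  fixes A :: "'a::{finite,order} set"
  defines "cs \<equiv> \<lambda>B. {C. C \<subseteq> B \<and> Complete_Partial_Order.chain (\<le>) C}"
  shows "(\<Sum>C\<in>cs A. (-1) ^ (card C + 1)) =
    - 1 - (\<Sum>v\<in>A. \<Sum>C\<in>cs {u \<in> A. u < v}. (-1) ^ (card C + 1) :: int)"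
proof -
  let ?T = "SIGMA v:A. cs {u \<in> A. u < v}"
  have bij: "bij_betw (\<lambda>(v, C). insert v C) ?T (cs A - {{}})"
  proof (rule bij_betw_imageI)
    \<comment> \<open>The added element is the greatest of the resulting chain, hence determined by
      it.\<close>
    have max: "v = w" if "insert v C = insert w D" "\<forall>c\<in>C. c < v" "\<forall>d\<in>D. d < w" for v w :: 'a and C D
    proof (rule ccontr)
      assume "v \<noteq> w"
      have "v \<in> insert w D" "w \<in> insert v C" using that(1) by blast+
      then have "v \<in> D" "w \<in> C" using \<open>v \<noteq> w\<close> by simp_all
      then have "v < w" "w < v" using that(2,3) by blast+
      then show False by simp
    qed
    show "inj_on (\<lambda>(v, C). insert v C) ?T"
    proof (rule inj_onI, clarify)
      fix v C w D assume *: "v \<in> A" "C \<in> cs {u \<in> A. u < v}" "w \<in> A" "D \<in> cs {u \<in> A. u < w}"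
        "insert v C = insert w D"
      have less: "\<forall>c\<in>C. c < v" "\<forall>d\<in>D. d < w" using * by (auto simp: cs_def)
      then have "v = w" using max * by blast
      moreover have "v \<notin> C" "w \<notin> D" using less by blast+
      ultimately show "v = w \<and> C = D" using *(5) by (metis insert_ident)
    qed
    show "(\<lambda>(v, C). insert v C) ` ?T = cs A - {{}}"
    proof (intro equalityI subsetI)
      fix X assume "X \<in> (\<lambda>(v, C). insert v C) ` ?T"
      then obtain v C where X: "X = insert v C" "v \<in> A" "C \<subseteq> {u \<in> A. u < v}"
        "Complete_Partial_Order.chain (\<le>) C" by (auto simp: cs_def)
      have "c \<le> v" if "c \<in> C" for c using X(3) that by (auto simp: less_imp_le)
      then have "Complete_Partial_Order.chain (\<le>) X"
        using X(4) unfolding X(1) Complete_Partial_Order.chain_def by blast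
      moreover have "X \<subseteq> A" using X(1-3) by blast
      ultimately show "X \<in> cs A - {{}}" using X(1) by (simp add: cs_def)
    next
      fix X assume X: "X \<in> cs A - {{}}"
      then have ch: "Complete_Partial_Order.chain (\<le>) X" and "X \<subseteq> A" "X \<noteq> {}"
        by (auto simp: cs_def)
      obtain v where v: "v \<in> X" "\<forall>u\<in>X. v \<le> u \<longrightarrow> v = u"
        using finite_has_maximal[OF finite \<open>X \<noteq> {}\<close>] by blast
      have "u < v" if "u \<in> X" "u \<noteq> v" for u
        using chainD_le[OF ch that(1) v(1)] v(2) that by auto
      then have "X - {v} \<in> cs {u \<in> A. u < v}"
        using \<open>X \<subseteq> A\<close> ch by (auto simp: cs_def Complete_Partial_Order.chain_def)
      then have "(v, X - {v}) \<in> ?T" using v(1) \<open>X \<subseteq> A\<close> by blast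
      then have "(\<lambda>(v, C). insert v C) (v, X - {v}) \<in> (\<lambda>(v, C). insert v C) ` ?T"
        by (rule imageI)
      then show "X \<in> (\<lambda>(v, C). insert v C) ` ?T"
        using v(1) by (simp add: insert_absorb)
    qed
  qed
  have empty: "{} \<in> cs A" by (simp add: cs_def Complete_Partial_Order.chain_def)
  have "(\<Sum>C\<in>cs A - {{}}. (-1) ^ (card C + 1)) =
      (\<Sum>p\<in>?T. (-1::int) ^ (card (case p of (v, C) \<Rightarrow> insert v C) + 1))"
    by (rule sum.reindex_bij_betw[OF bij, symmetric])
  also have "\<dots> = (\<Sum>p\<in>?T. - ((-1) ^ (card (snd p) + 1)))"
  proof (rule sum.cong[OF refl])
    fix p assume p: "p \<in> ?T"
    have "fst p \<notin> snd p" using p by (auto simp: cs_def)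
    then show "(-1::int) ^ (card (case p of (v, C) \<Rightarrow> insert v C) + 1) = - ((-1) ^ (card (snd p) + 1))"
      by (simp add: case_prod_unfold)
  qed
  also have "\<dots> = - (\<Sum>v\<in>A. \<Sum>C\<in>cs {u \<in> A. u < v}. (-1) ^ (card C + 1))"
    by (simp add: sum.Sigma sum_negf case_prod_unfold)
  finally show ?thesis
    using sum.remove[OF finite empty, of "\<lambda>C. (-1::int) ^ (card C + 1)"] by simp
qed

text \<open>Both sides satisfy the same recursion on \<open>w\<close>: the summand
  \<open>mobius u u\<close> corresponds to the empty chain, and the remaining summands to the
  greatest element of a nonempty chain.\<close>

theorem mobius_eq_sum_chains:
  fixes u w :: "'a::{finite,order}"
  assumes "u < w"
  shows "mobius u w =
    (\<Sum>C\<in>{C. C \<subseteq> {v. u < v \<and> v < w} \<and> Complete_Partial_Order.chain (\<le>) C}. (-1) ^ (card C + 1))"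
  using assms
proof (induction "card {v. v < w}" arbitrary: w rule: less_induct)
  case less
  let ?A = "{v. u < v \<and> v < w}"
  let ?chains = "\<lambda>B. {C. C \<subseteq> B \<and> Complete_Partial_Order.chain (\<le>) C}"
  have "{v. u \<le> v \<and> v < w} = insert u ?A" using less.prems by (auto simp: less_le)
  then have "mobius u w = - (mobius u u + (\<Sum>v\<in>?A. mobius u v))"
    using less.prems by (subst mobius.simps) (simp add: less_imp_neq)
  also have "\<dots> = - 1 - (\<Sum>v\<in>?A. mobius u v)" by (simp add: mobius.simps[of u u])
  also have "(\<Sum>v\<in>?A. mobius u v) =
      (\<Sum>v\<in>?A. \<Sum>C\<in>?chains {x \<in> ?A. x < v}. (-1) ^ (card C + 1))"
  proof (rule sum.cong[OF refl])
    fix v assume v: "v \<in> ?A"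
    have "{x. x < v} \<subset> {x. x < w}" using v by force
    then have "card {x. x < v} < card {x. x < w}" by (intro psubset_card_mono) simp_all
    moreover have "{x \<in> ?A. x < v} = {x. u < x \<and> x < v}" using v by auto
    ultimately show "mobius u v = (\<Sum>C\<in>?chains {x \<in> ?A. x < v}. (-1) ^ (card C + 1))"
      using less.hyps[of v] v by simp
  qed
  finally show ?case unfolding sum_sign_chains[of ?A] .
qed

section \<open>Faces of the order complex sorted by earliest facet\<close>

lemma mobius_eq_sum_order_complex:
  assumes "(bot::'a::{finite,order_bot,order_top}) \<noteq> top"
  shows "mobius (bot::'a) top = (\<Sum>C\<in>(order_complex :: 'a set set). (-1) ^ (card C + 1))"
proof -
  have "order_complex = {C. C \<subseteq> {v::'a. bot < v \<and> v < top} \<and> Complete_Partial_Order.chain (\<le>) C}"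
    unfolding order_complex_def by (auto simp flip: bot.not_eq_extremum top.not_eq_extremum)
  then show ?thesis
    using mobius_eq_sum_chains[of "bot::'a" top] assms by (simp add: top.not_eq_extremum)
qed

lemma order_complex_subset_facet:
  assumes "s \<in> (order_complex :: 'a::{finite,order_bot,order_top} set set)"
  shows "\<exists>C\<in>facets order_complex. s \<subseteq> C"
proof -
  obtain C where "C \<in> order_complex" "s \<subseteq> C" "\<forall>D\<in>order_complex. C \<subseteq> D \<longrightarrow> C = D"
    using finite_has_maximal2[OF finite assms] by blast
  then show ?thesis unfolding facets_def by (intro bexI[of _ C]) auto
qed

lemma new_faces_earliest:
  assumes "k \<in> {1..N}" "h \<in> new_faces F k"
  shows "earliest N F h = k"
  unfolding earliest_def
proof (rule Least_equality)
  show "k \<in> {1..N} \<and> h \<subseteq> F k" using assms by (simp add: new_faces_def)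
  fix i assume i: "i \<in> {1..N} \<and> h \<subseteq> F i"
  show "k \<le> i"
  proof (rule ccontr)
    assume "\<not> k \<le> i"
    then have "h \<in> earlier_faces F k"
      unfolding earlier_faces_def by (intro UN_I[of i]) (use i in auto)
    then show False using assms(2) by (simp add: new_faces_def)
  qed
qed

lemma order_complex_new_faces:
  fixes F :: "nat \<Rightarrow> 'a::{finite,order_bot,order_top} set"
  assumes "F ` {1..N} = facets order_complex"
  shows "order_complex = (\<Union>k\<in>{1..N}. new_faces F k)"
proof (intro equalityI subsetI)
  fix s :: "'a set" assume "s \<in> order_complex"
  then obtain i where i: "i \<in> {1..N} \<and> s \<subseteq> F i"
    using order_complex_subset_facet assms by (metis imageE)
  define k where "k = (LEAST k. k \<in> {1..N} \<and> s \<subseteq> F k)"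
  have k: "k \<in> {1..N}" "s \<subseteq> F k"
    using LeastI[of "\<lambda>k. k \<in> {1..N} \<and> s \<subseteq> F k", OF i] unfolding k_def by blast+
  have "s \<notin> earlier_faces F k"
  proof
    assume "s \<in> earlier_faces F k"
    then obtain l where "l \<in> {1..<k}" "s \<subseteq> F l" unfolding earlier_faces_def by blast
    then show False
      using not_less_Least[of l "\<lambda>k. k \<in> {1..N} \<and> s \<subseteq> F k"] k(1) unfolding k_def[symmetric] by simp
  qed
  then show "s \<in> (\<Union>k\<in>{1..N}. new_faces F k)" using k by (auto simp: new_faces_def)
next
  fix s assume "s \<in> (\<Union>k\<in>{1..N}. new_faces F k)"
  then obtain k where k: "k \<in> {1..N}" "s \<subseteq> F k" unfolding new_faces_def by blast
  then have "F k \<in> order_complex" using assms by (auto simp: facets_def)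
  then show "s \<in> order_complex"
    using k(2) by (auto simp: order_complex_def Complete_Partial_Order.chain_def)
qed

theorem proposition3p1:
  fixes F :: "nat \<Rightarrow> 'a::{finite,order_bot,order_top} set" and N :: nat
  assumes "(bot::'a) \<noteq> top"
    and "lexicographic_order N F"
  shows "mobius (bot::'a) top =
    (\<Sum>\<sigma>\<in>critical_cells N F. (-1) ^ (card (J_intervals F (earliest N F \<sigma>)) + 1))"
proof -
  let ?K = "{1..N}"
  let ?U = "facet_intervals.unmatched F"
  have img: "F ` ?K = facets order_complex"
    using assms(2) by (simp add: lexicographic_order_def bij_betw_def)
  have loc: "facet_intervals F k" if "k \<in> ?K" for k
  proof
    show "Complete_Partial_Order.chain (\<le>) (F k)" using img that by (intro facets_chain) blast
    show "\<forall>B\<in>skipped_intervals F k. interval_of (F k) B"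
      using skipped_intervals_interval[OF assms(2) that] by blast
  qed
  have U: "?U k = {h \<in> new_faces F k. \<not> (\<exists>p\<in>matching_pairs F k. h \<in> p)}" if "k \<in> ?K" for k
    using facet_intervals.unmatched_def[OF loc[OF that]] .
  have disj: "k = l" if "k \<in> ?K" "l \<in> ?K" "h \<in> new_faces F k" "h \<in> new_faces F l" for k l h
    using new_faces_earliest[OF that(1,3)] new_faces_earliest[OF that(2,4)] by simp
  note oc = order_complex_new_faces[OF img]
  \<comment> \<open>Pairs of another facet consist of new faces of that facet, and a face is new in
    one facet only. So being critical can be tested inside the earliest facet.\<close>
  have crit: "critical_cells N F = (\<Union>k\<in>?K. ?U k)"
  proof (intro equalityI subsetI)
    fix h assume h: "h \<in> critical_cells N F"
    then have "h \<in> order_complex" by (simp add: critical_cells_def)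
    then obtain k where k: "k \<in> ?K" "h \<in> new_faces F k" unfolding oc by blast
    have "\<not> (\<exists>p\<in>matching_pairs F k. h \<in> p)"
      using h k(1) unfolding critical_cells_def lexicographic_matching_def by blast
    then show "h \<in> (\<Union>k\<in>?K. ?U k)" using k U[OF k(1)] by blast
  next
    fix h assume "h \<in> (\<Union>k\<in>?K. ?U k)"
    then obtain k where k: "k \<in> ?K" "h \<in> new_faces F k" "\<not> (\<exists>p\<in>matching_pairs F k. h \<in> p)"
      using U by blast
    have "\<not> (\<exists>p\<in>lexicographic_matching N F. h \<in> p)"
    proof
      assume "\<exists>p\<in>lexicographic_matching N F. h \<in> p"
      then obtain l p where l: "l \<in> ?K" "p \<in> matching_pairs F l" "h \<in> p"
        unfolding lexicographic_matching_def by blast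
      then have "h \<in> new_faces F l"
        using bspec[OF facet_intervals.matching_pairs_subset[OF loc[OF l(1)]] l(2)] by blast
      then show False using disj[OF k(1) l(1) k(2)] k(3) l(2,3) by blast
    qed
    moreover have "h \<in> order_complex" using k unfolding oc by blast
    ultimately show "h \<in> critical_cells N F" by (simp add: critical_cells_def)
  qed
  have "mobius (bot::'a) top = (\<Sum>h\<in>(order_complex :: 'a set set). (-1) ^ (card h + 1))"
    by (rule mobius_eq_sum_order_complex[OF assms(1)])
  also have "\<dots> = (\<Sum>k\<in>?K. \<Sum>h\<in>new_faces F k. (-1) ^ (card h + 1))"
    unfolding oc by (rule sum.UNION_disjoint) (use disj in auto)
  also have "\<dots> = (\<Sum>k\<in>?K. \<Sum>h\<in>?U k. (-1) ^ (card (J_intervals F k) + 1))"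
    by (rule sum.cong[OF refl]) (rule facet_intervals.sum_new_faces[OF loc])
  \<comment> \<open>Unmatched faces are new in \<open>F k\<close>, so \<open>k\<close> is their
    earliest index; this makes the summand independent of \<open>k\<close> before the sums are
    merged.\<close>
  also have "\<dots> = (\<Sum>k\<in>?K. \<Sum>h\<in>?U k. (-1) ^ (card (J_intervals F (earliest N F h)) + 1))"
    by (intro sum.cong refl) (simp add: U new_faces_earliest)
  also have "\<dots> = (\<Sum>h\<in>critical_cells N F. (-1) ^ (card (J_intervals F (earliest N F h)) + 1))"
    unfolding crit by (rule sum.UNION_disjoint[symmetric]) (use disj U in auto)
  finally show ?thesis .
qed

end
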